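(* Let $G$ be a densely ordered abelian group. Suppose that there exists some $n\in\mathbb{N}$ such that $G$ contains a convex subgroup $C$ that is $n$-regular but not $n$-divisible. Then $G$ is not closed in its divisible hull $G^{\mathrm{div}}$.
   Context: $\mathbb{N}=\{1,2,\ldots\}$. An ordered abelian group $G$ is discretely ordered if it has a least positive element, and densely ordered if it is not discretely ordered. For $n\in\mathbb{N}$, an ordered abelian group $C$ is $n$-regular if every infinite convex subset of $C$ contains at least one $n$-divisible element, i.e. an element of the form $nz$ with $z\in C$; it is $n$-divisible if $C=nC$. $G^{\mathrm{div}}$ denotes the divisible hull of $G$ with the unique ordering extending that of $G$; "closed" refers to the order topology on $G^{\mathrm{div}}$. *)

theory Defs
  imports Complex_Main
begin

section \<open>Ordered abelian groups\<close>

text \<open>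
  Ordered abelian groups (always linearly ordered) are the types of class
  \<^class>\<open>linordered_ab_group_add\<close>; subgroups are subsets of such a type, so that the
  notions below are relativised to a carrier set.
\<close>

definition nsmul :: "nat \<Rightarrow> 'a::comm_monoid_add \<Rightarrow> 'a"
  where "nsmul n x = (\<Sum>i<n. x)"

definition is_subgroup :: "'a::ab_group_add set \<Rightarrow> bool"
  where "is_subgroup C \<longleftrightarrow> 0 \<in> C \<and> (\<forall>x\<in>C. \<forall>y\<in>C. x + y \<in> C) \<and> (\<forall>x\<in>C. - x \<in> C)"

definition order_convex_in :: "'a::linorder set \<Rightarrow> 'a set \<Rightarrow> bool"
  where "order_convex_in C D \<longleftrightarrow>
    D \<subseteq> C \<and> (\<forall>x\<in>D. \<forall>y\<in>D. \<forall>z\<in>C. x \<le> z \<and> z \<le> y \<longrightarrow> z \<in> D)"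

definition discretely_ordered :: "'a::linordered_ab_group_add set \<Rightarrow> bool"
  where "discretely_ordered G \<longleftrightarrow> (\<exists>e\<in>G. 0 < e \<and> (\<forall>x\<in>G. 0 < x \<longrightarrow> e \<le> x))"

definition densely_ordered :: "'a::linordered_ab_group_add set \<Rightarrow> bool"
  where "densely_ordered G \<longleftrightarrow> \<not> discretely_ordered G"

definition n_divisible :: "nat \<Rightarrow> 'a::ab_group_add set \<Rightarrow> bool"
  where "n_divisible n C \<longleftrightarrow> C = nsmul n ` C"

definition n_regular :: "nat \<Rightarrow> 'a::linordered_ab_group_add set \<Rightarrow> bool"
  where "n_regular n C \<longleftrightarrow>
    (\<forall>D. order_convex_in C D \<and> infinite D \<longrightarrow> (\<exists>z\<in>C. nsmul n z \<in> D))"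


section \<open>The divisible hull\<close>

lemma nsmul_0 [simp]: "nsmul 0 x = 0"
  by (simp add: nsmul_def)

lemma nsmul_Suc [simp]: "nsmul (Suc n) x = x + nsmul n x"
  by (simp add: nsmul_def add.commute)

lemma nsmul_zero [simp]: "nsmul n 0 = 0"
  by (simp add: nsmul_def)

lemma nsmul_one [simp]: "nsmul 1 x = x"
  by (simp add: nsmul_def)

lemma nsmul_add: "nsmul n (x + y) = nsmul n x + nsmul n y"
  by (simp add: nsmul_def sum.distrib)

lemma nsmul_uminus: "nsmul n (- x) = - nsmul n (x :: 'a::ab_group_add)"
  by (simp add: nsmul_def sum_negf)

lemma nsmul_add_left: "nsmul (m + n) x = nsmul m x + nsmul n x"
  by (induction m) (simp_all add: add.assoc)

lemma nsmul_nsmul: "nsmul m (nsmul n x) = nsmul (m * n) x"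
  by (induction m) (simp_all add: nsmul_add_left)

lemma nsmul_commute: "nsmul m (nsmul n x) = nsmul n (nsmul m x)"
  by (simp add: nsmul_nsmul mult.commute)

lemma nsmul_strict_mono:
  "nsmul n x < nsmul n y" if "n > 0" "x < y" for x y :: "'a::linordered_ab_group_add"
  unfolding nsmul_def using that by (intro sum_strict_mono) auto

lemma nsmul_less_iff [simp]:
  "n > 0 \<Longrightarrow> nsmul n x < nsmul n y \<longleftrightarrow> x < y" for x y :: "'a::linordered_ab_group_add"
  by (metis nsmul_strict_mono less_asym linorder_neqE)

lemma nsmul_le_iff [simp]:
  "n > 0 \<Longrightarrow> nsmul n x \<le> nsmul n y \<longleftrightarrow> x \<le> y" for x y :: "'a::linordered_ab_group_add"
  by (meson not_le nsmul_less_iff)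

lemma nsmul_eq_iff [simp]:
  "n > 0 \<Longrightarrow> nsmul n x = nsmul n y \<longleftrightarrow> x = y" for x y :: "'a::linordered_ab_group_add"
  by (metis nsmul_strict_mono less_irrefl linorder_neqE)

text \<open>
  The divisible hull is the group of formal fractions \<open>a / m\<close> with \<open>a\<close> in the group and
  \<open>m\<close> a positive natural number. As ordered groups are torsion-free, \<open>a / m = b / n\<close>
  amounts to \<open>n a = m b\<close>.
\<close>

definition divhull_rel :: "'a::linordered_ab_group_add \<times> nat \<Rightarrow> 'a \<times> nat \<Rightarrow> bool"
  where "divhull_rel p q \<longleftrightarrow>
    snd p > 0 \<and> snd q > 0 \<and> nsmul (snd q) (fst p) = nsmul (snd p) (fst q)"

lemma part_equivp_divhull_rel:
  "part_equivp (divhull_rel :: 'a::linordered_ab_group_add \<times> nat \<Rightarrow> _)"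
proof (rule part_equivpI)
  show "\<exists>x :: 'a \<times> nat. divhull_rel x x"
    by (rule exI[of _ "(0, 1)"]) (simp add: divhull_rel_def)
  show "symp (divhull_rel :: 'a \<times> nat \<Rightarrow> _)"
    by (auto simp: symp_def divhull_rel_def)
  show "transp (divhull_rel :: 'a \<times> nat \<Rightarrow> _)"
  proof (rule transpI, unfold split_paired_all)
    fix a b c :: 'a and k m n :: nat
    assume "divhull_rel (a, k) (b, m)" "divhull_rel (b, m) (c, n)"
    then have pos: "k > 0" "m > 0" "n > 0"
      and ab: "nsmul m a = nsmul k b" and bc: "nsmul n b = nsmul m c"
      by (auto simp: divhull_rel_def)
    have "nsmul m (nsmul n a) = nsmul m (nsmul k c)"
      by (metis ab bc nsmul_commute)
    with pos show "divhull_rel (a, k) (c, n)"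
      by (simp add: divhull_rel_def)
  qed
qed

quotient_type (overloaded) 'a divhull =
  "'a::linordered_ab_group_add \<times> nat" / partial: divhull_rel
  by (rule part_equivp_divhull_rel)

instantiation divhull :: (linordered_ab_group_add) linordered_ab_group_add
begin

lift_definition zero_divhull :: "'a divhull" is "(0, 1)"
  by (simp add: divhull_rel_def)

lift_definition plus_divhull :: "'a divhull \<Rightarrow> 'a divhull \<Rightarrow> 'a divhull"
  is "\<lambda>p q. (nsmul (snd q) (fst p) + nsmul (snd p) (fst q), snd p * snd q)"
proof -
  fix p p' q q' :: "'a \<times> nat"
  assume "divhull_rel p p'" "divhull_rel q q'"
  then have pos: "snd p > 0" "snd p' > 0" "snd q > 0" "snd q' > 0"
    and p: "nsmul (snd p') (fst p) = nsmul (snd p) (fst p')"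
    and q: "nsmul (snd q') (fst q) = nsmul (snd q) (fst q')"
    by (auto simp: divhull_rel_def)
  have 1: "nsmul (snd p' * snd q') (nsmul (snd q) (fst p))
      = nsmul (snd p * snd q) (nsmul (snd q') (fst p'))"
    using arg_cong[OF p, of "nsmul (snd q' * snd q)"] by (simp add: nsmul_nsmul mult_ac)
  have 2: "nsmul (snd p' * snd q') (nsmul (snd p) (fst q))
      = nsmul (snd p * snd q) (nsmul (snd p') (fst q'))"
    using arg_cong[OF q, of "nsmul (snd p' * snd p)"] by (simp add: nsmul_nsmul mult_ac)
  show "divhull_rel (nsmul (snd q) (fst p) + nsmul (snd p) (fst q), snd p * snd q)
     (nsmul (snd q') (fst p') + nsmul (snd p') (fst q'), snd p' * snd q')"
    using pos 1 2 by (simp add: divhull_rel_def nsmul_add)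
qed

lift_definition uminus_divhull :: "'a divhull \<Rightarrow> 'a divhull"
  is "\<lambda>p. (- fst p, snd p)"
  by (simp add: divhull_rel_def nsmul_uminus)

definition minus_divhull :: "'a divhull \<Rightarrow> 'a divhull \<Rightarrow> 'a divhull"
  where "minus_divhull p q = p + - q"

lift_definition less_eq_divhull :: "'a divhull \<Rightarrow> 'a divhull \<Rightarrow> bool"
  is "\<lambda>p q. nsmul (snd q) (fst p) \<le> nsmul (snd p) (fst q)"
proof -
  fix p p' q q' :: "'a \<times> nat"
  assume "divhull_rel p p'" "divhull_rel q q'"
  then have pos: "snd p > 0" "snd p' > 0" "snd q > 0" "snd q' > 0"
    and p: "nsmul (snd p') (fst p) = nsmul (snd p) (fst p')"
    and q: "nsmul (snd q') (fst q) = nsmul (snd q) (fst q')"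
    by (auto simp: divhull_rel_def)
  have "nsmul (snd q) (fst p) \<le> nsmul (snd p) (fst q) \<longleftrightarrow>
      nsmul (snd p' * snd q') (nsmul (snd q) (fst p)) \<le>
      nsmul (snd p' * snd q') (nsmul (snd p) (fst q))"
    using pos by simp
  also have "nsmul (snd p' * snd q') (nsmul (snd q) (fst p))
      = nsmul (snd p * snd q) (nsmul (snd q') (fst p'))"
    using arg_cong[OF p, of "nsmul (snd q' * snd q)"] by (simp add: nsmul_nsmul mult_ac)
  also have "nsmul (snd p' * snd q') (nsmul (snd p) (fst q))
      = nsmul (snd p * snd q) (nsmul (snd p') (fst q'))"
    using arg_cong[OF q, of "nsmul (snd p' * snd p)"] by (simp add: nsmul_nsmul mult_ac)
  finally show "nsmul (snd q) (fst p) \<le> nsmul (snd p) (fst q) \<longleftrightarrow>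
      nsmul (snd q') (fst p') \<le> nsmul (snd p') (fst q')"
    using pos by simp
qed

definition less_divhull :: "'a divhull \<Rightarrow> 'a divhull \<Rightarrow> bool"
  where "less_divhull p q \<longleftrightarrow> p \<le> q \<and> \<not> q \<le> p"

instance
proof
  fix p q r :: "'a divhull"
  show "p + q + r = p + (q + r)"
    by transfer (auto simp: divhull_rel_def nsmul_add nsmul_nsmul mult_ac add_ac)
  show "p + q = q + p"
    by transfer (auto simp: divhull_rel_def nsmul_add nsmul_nsmul mult_ac add_ac)
  show "0 + p = p"
    by transfer (auto simp: divhull_rel_def)
  show "- p + p = 0"
    by transfer (auto simp: divhull_rel_def nsmul_uminus)
  show "p - q = p + - q"
    by (simp add: minus_divhull_def)
  show "p < q \<longleftrightarrow> p \<le> q \<and> \<not> q \<le> p"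
    by (simp add: less_divhull_def)
  show "p \<le> p"
    by transfer simp
  show "p \<le> q \<Longrightarrow> q \<le> p \<Longrightarrow> p = q"
    by transfer (auto simp: divhull_rel_def)
  show "p \<le> q \<or> q \<le> p"
    by transfer auto
  show "p \<le> r" if "p \<le> q" "q \<le> r"
    using that
  proof (transfer, goal_cases)
    case (1 p q r)
    have pos: "snd p > 0" "snd q > 0" "snd r > 0"
      using 1 by (auto simp: divhull_rel_def)
    have "nsmul (snd q) (nsmul (snd r) (fst p)) = nsmul (snd r) (nsmul (snd q) (fst p))"
      by (rule nsmul_commute)
    also have "\<dots> \<le> nsmul (snd r) (nsmul (snd p) (fst q))"
      using 1 pos by simp
    also have "\<dots> = nsmul (snd p) (nsmul (snd r) (fst q))"
      by (rule nsmul_commute)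
    also have "\<dots> \<le> nsmul (snd p) (nsmul (snd q) (fst r))"
      using 1 pos by simp
    also have "\<dots> = nsmul (snd q) (nsmul (snd p) (fst r))"
      by (rule nsmul_commute)
    finally show ?case
      using pos by simp
  qed
  show "r + p \<le> r + q" if "p \<le> q"
    using that
  proof (transfer, goal_cases)
    case (1 p q r)
    have pos: "snd p > 0" "snd q > 0" "snd r > 0"
      using 1 by (auto simp: divhull_rel_def)
    have "nsmul (snd r * snd r) (nsmul (snd q) (fst p)) \<le>
        nsmul (snd r * snd r) (nsmul (snd p) (fst q))"
      using 1 pos by simp
    then show ?case
      by (simp add: nsmul_add nsmul_nsmul mult_ac)
  qed
qed

end

instantiation divhull :: (linordered_ab_group_add) linorder_topology
begin

definition open_divhull :: "'a divhull set \<Rightarrow> bool"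
  where "open_divhull = generate_topology (range lessThan \<union> range greaterThan)"

instance
  by standard (simp add: open_divhull_def)

end

lift_definition divhull_embed :: "'a::linordered_ab_group_add \<Rightarrow> 'a divhull"
  is "\<lambda>a. (a, 1)"
  by (simp add: divhull_rel_def)

text \<open>
  The following facts characterise the divisible hull up to a unique isomorphism of
  ordered groups over the given group.
\<close>

lemma divhull_embed_add: "divhull_embed (a + b) = divhull_embed a + divhull_embed b"
  by transfer (simp add: divhull_rel_def)

lemma divhull_embed_le_iff: "divhull_embed a \<le> divhull_embed b \<longleftrightarrow> a \<le> b"
  by transfer simp

lemma inj_divhull_embed: "inj divhull_embed"
  by (rule injI) (metis divhull_embed_le_iff order_antisym order_refl)

lemma divhull_embed_nsmul: "divhull_embed (nsmul n a) = nsmul n (divhull_embed a)"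
proof (induction n)
  case 0
  show ?case by simp (transfer, simp add: divhull_rel_def)
qed (simp add: divhull_embed_add)

lemma abs_divhull_eqI: "divhull_rel p q \<Longrightarrow> abs_divhull p = abs_divhull q"
  by (rule Quotient3_rel_abs[OF Quotient3_divhull])

lemma nsmul_abs_divhull:
  "m > 0 \<Longrightarrow> nsmul n (abs_divhull (a, m)) = abs_divhull (nsmul n a, m)"
proof (induction n)
  case 0
  then show ?case
    by (auto simp: zero_divhull_def divhull_rel_def intro!: abs_divhull_eqI)
next
  case (Suc n)
  have eq: "divhull_rel (a, m) (a, m)" "divhull_rel (nsmul n a, m) (nsmul n a, m)"
    using Suc.prems by (simp_all add: divhull_rel_def)
  have "nsmul (Suc n) (abs_divhull (a, m)) = abs_divhull (a, m) + abs_divhull (nsmul n a, m)"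
    using Suc by simp
  also have "\<dots> = abs_divhull (nsmul m a + nsmul m (nsmul n a), m * m)"
    using plus_divhull.abs_eq[OF eq] by simp
  also have "\<dots> = abs_divhull (nsmul (Suc n) a, m)"
    using Suc.prems
    by (intro abs_divhull_eqI) (simp add: divhull_rel_def nsmul_add nsmul_nsmul mult_ac)
  finally show ?case .
qed

lemma divhull_cases:
  obtains a m where "m > 0" "p = abs_divhull (a, m)"
proof (induction p rule: divhull.abs_induct)
  case (1 y)
  then show ?case by (cases y) (auto simp: divhull_rel_def)
qed

lemma divhull_divisible: "\<exists>q :: 'a::linordered_ab_group_add divhull. nsmul n q = p" if "n > 0"
proof -
  obtain a m where m: "m > 0" and p: "p = abs_divhull (a, m)"
    by (rule divhull_cases)
  have "nsmul n (abs_divhull (a, n * m)) = p"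
    unfolding p using m that
    by (subst nsmul_abs_divhull)
       (auto simp: divhull_rel_def nsmul_nsmul mult_ac intro!: abs_divhull_eqI)
  then show ?thesis ..
qed

lemma divhull_multiple_in_range:
  "\<exists>n>0. nsmul n p \<in> range divhull_embed" for p :: "'a::linordered_ab_group_add divhull"
proof -
  obtain a m where m: "m > 0" and p: "p = abs_divhull (a, m)"
    by (rule divhull_cases)
  have "nsmul m p = divhull_embed a"
    unfolding p using m
    by (subst nsmul_abs_divhull)
       (auto simp: divhull_embed.abs_eq divhull_rel_def intro!: abs_divhull_eqI)
  with m show ?thesis by auto
qed

end

theory Submission
  imports Defs
begin

text \<open>
  Take \<open>c \<in> C\<close> outside \<open>n C\<close>. The point \<open>c / n\<close> of the hull is not in \<open>G\<close>: by convexity an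
  \<open>n\<close>-th part of \<open>c\<close> in \<open>G\<close> would lie in \<open>C\<close>. But \<open>c / n\<close> is a limit of elements of \<open>G\<close>:
  as \<open>G\<close> is densely ordered, below every positive element of the hull there is some
  \<open>0 < d \<in> C\<close>. The interval \<open>(c, c + d)\<close> of \<open>C\<close> is infinite, so by regularity it contains some
  \<open>n z\<close>, and \<open>z\<close> is close to \<open>c / n\<close>.
\<close>

lemma nsmul_in_subgroup: "is_subgroup C \<Longrightarrow> x \<in> C \<Longrightarrow> nsmul n x \<in> C"
  by (induction n) (auto simp: is_subgroup_def)

lemma le_nsmul:
  fixes x :: "'a::linordered_ab_group_add"
  assumes "n \<ge> 1" "0 \<le> x"
  shows "x \<le> nsmul n x"
proof -
  obtain m where n: "n = Suc m"
    using assms(1) by (cases n) auto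
  have "0 \<le> nsmul m x"
    unfolding nsmul_def using assms(2) by (intro sum_nonneg)
  then show ?thesis
    by (simp add: n)
qed

lemma divhull_embed_less_iff: "divhull_embed a < divhull_embed b \<longleftrightarrow> a < b"
  by (simp add: divhull_embed_le_iff flip: not_le)

lemma divhull_embed_zero: "divhull_embed 0 = 0"
  using divhull_embed_add[of 0 0] by simp

lemma subgroup_abs:
  fixes C :: "'a::linordered_ab_group_add set"
  shows "is_subgroup C \<Longrightarrow> x \<in> C \<Longrightarrow> max x (- x) \<in> C"
  by (auto simp: is_subgroup_def max_def)

text \<open>Whatever the sign of \<open>x\<close>, it lies between \<open>0\<close> and
  \<open>nsmul n x\<close>, so convexity applies; the negative case is the positive one for
  \<open>- x\<close>.\<close>

lemma convex_subgroup_divisor: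
  fixes C :: "'a::linordered_ab_group_add set"
  assumes C: "is_subgroup C" "order_convex_in UNIV C"
    and n: "n \<ge> 1" and x: "nsmul n x \<in> C"
  shows "x \<in> C"
proof -
  have C0: "0 \<in> C"
    using C(1) by (simp add: is_subgroup_def)
  show ?thesis
  proof (cases "0 \<le> x")
    case True
    then have "0 \<le> x" "x \<le> nsmul n x"
      using le_nsmul n by auto
    with C(2) C0 x show ?thesis
      unfolding order_convex_in_def by blast
  next
    case False
    then have "x \<le> 0" "nsmul n x \<le> x"
      using le_nsmul[OF n, of "- x"] by (auto simp: nsmul_uminus)
    with C(2) C0 x show ?thesis
      unfolding order_convex_in_def by blast
  qed
qed

lemma densely_ordered_between:
  fixes a :: "'a::linordered_ab_group_add"
  assumes "densely_ordered (UNIV :: 'a set)" "0 < a"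
  shows "\<exists>d. 0 < d \<and> d < a"
  using assms by (auto simp: densely_ordered_def discretely_ordered_def not_le)

text \<open>Each induction step splits \<open>a\<close> into two positive parts \<open>d\<close> and
  \<open>a - d\<close>: the first bounds the new summand, the second the remaining \<open>m\<close>
  summands, and the minimum of the two witnesses respects both bounds.\<close>

lemma densely_ordered_small_multiple:
  fixes a :: "'a::linordered_ab_group_add"
  assumes dense: "densely_ordered (UNIV :: 'a set)" and "0 < a"
  shows "\<exists>d>0. nsmul m d \<le> a"
  using assms(2)
proof (induction m arbitrary: a)
  case 0
  then show ?case
    by (intro exI[of _ a]) auto
next
  case (Suc m)
  obtain d where d: "0 < d" "d < a"
    using densely_ordered_between[OF dense Suc.prems] by blast
  obtain e where e: "0 < e" "nsmul m e \<le> a - d"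
    using Suc.IH[of "a - d"] d by auto
  have "nsmul m (min d e) \<le> nsmul m e"
    unfolding nsmul_def by (intro sum_mono) auto
  then have "min d e + nsmul m (min d e) \<le> d + (a - d)"
    using e by (intro add_mono) auto
  then show ?case
    using d e by (intro exI[of _ "min d e"]) auto
qed

lemma densely_ordered_infinite_interval:
  fixes c d :: "'a::linordered_ab_group_add"
  assumes dense: "densely_ordered (UNIV :: 'a set)" and "0 < d"
  shows "infinite {c<..<c + d}"
proof
  assume fin: "finite {c<..<c + d}"
  obtain y where y: "0 < y" "y < d"
    using densely_ordered_between[OF assms] by blast
  \<comment> \<open>A least element of the interval is contradictory: density gives a positive
    \<open>z\<close> below \<open>m - c\<close>, and \<open>c + z\<close> is a smaller
    element.\<close>
  define m where "m = Min {c<..<c + d}"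
  have "c + y \<in> {c<..<c + d}"
    using y by simp
  then have "m \<in> {c<..<c + d}"
    unfolding m_def using fin by (intro Min_in) blast+
  then have m: "c < m" "m < c + d"
    by auto
  obtain z where z: "0 < z" "z < m - c"
    using densely_ordered_between[OF dense, of "m - c"] m by auto
  have lt: "c + z < m"
    using z by (simp add: less_diff_eq add.commute)
  then have "c + z \<in> {c<..<c + d}"
    using z(1) less_trans[OF lt m(2)] by simp
  then have "m \<le> c + z"
    unfolding m_def using fin by (intro Min_le)
  with lt show False
    by simp
qed

text \<open>Clearing the denominator \<open>m\<close> of \<open>e\<close> turns the claim into one
  about \<open>nsmul m d\<close> in the group itself.\<close>

lemma divhull_embed_below:
  fixes e :: "'a::linordered_ab_group_add divhull"
  assumes dense: "densely_ordered (UNIV :: 'a set)" and e: "0 < e"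
  shows "\<exists>d>0. divhull_embed d \<le> e"
proof -
  obtain m a where m: "m > 0" and a: "nsmul m e = divhull_embed a"
    using divhull_multiple_in_range[of e] by auto
  have "divhull_embed 0 < divhull_embed a"
    using nsmul_strict_mono[OF m e] by (simp add: a divhull_embed_zero)
  then have "0 < a"
    by (simp only: divhull_embed_less_iff)
  then obtain d where d: "0 < d" "nsmul m d \<le> a"
    using densely_ordered_small_multiple[OF dense] by blast
  have "nsmul m (divhull_embed d) \<le> nsmul m e"
    unfolding a using d(2) by (simp add: divhull_embed_le_iff flip: divhull_embed_nsmul)
  with m d(1) show ?thesis
    by auto
qed

lemma n_regular_approx:
  fixes C :: "'a::linordered_ab_group_add set"
  assumes dense: "densely_ordered (UNIV :: 'a set)"
    and C: "is_subgroup C" "order_convex_in UNIV C" "n_regular n C"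
    and c: "c \<in> C" "c \<noteq> 0" and d: "0 < d"
  shows "\<exists>z. c < nsmul n z \<and> nsmul n z < c + d"
proof -
  \<comment> \<open>The given \<open>d\<close> may reach beyond \<open>C\<close>. Capping it at the
    absolute value of \<open>c\<close>, positive since \<open>c \<noteq> 0\<close>, keeps the
    interval between \<open>c\<close> and \<open>c + p\<close>, both in \<open>C\<close>, so that
    regularity applies to it.\<close>
  define p where "p = max c (- c)"
  have p: "p \<in> C" "0 < p"
    using subgroup_abs[OF C(1) c(1)] c(2) by (auto simp: p_def max_def)
  define d' where "d' = min d p"
  have d': "0 < d'" "d' \<le> d" "d' \<le> p"
    using d p by (auto simp: d'_def)
  have cp: "c + p \<in> C"
    using C(1) c(1) p(1) by (simp add: is_subgroup_def)
  have "x \<in> C" if "c < x" "x < c + d'" for x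
  proof -
    have "c \<le> x" "x \<le> c + p"
      using that d'(3) by (auto intro: order.trans[OF less_imp_le])
    with c(1) cp C(2) show ?thesis
      unfolding order_convex_in_def by blast
  qed
  then have "order_convex_in C {c<..<c + d'}"
    by (auto simp: order_convex_in_def)
  then obtain z where "nsmul n z \<in> {c<..<c + d'}"
    using C(3) densely_ordered_infinite_interval[OF dense d'(1)]
    unfolding n_regular_def by blast
  then show ?thesis
    using d'(2) by (intro exI[of _ z]) (auto intro: less_le_trans)
qed

theorem proposition3p3:
  assumes "densely_ordered (UNIV :: 'a::linordered_ab_group_add set)"
    and "\<exists>n\<ge>1. \<exists>C :: 'a set. is_subgroup C \<and> order_convex_in UNIV C \<and>
           n_regular n C \<and> \<not> n_divisible n C"
  shows "\<not> closed (range (divhull_embed :: 'a \<Rightarrow> 'a divhull))"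
proof
  assume closed: "closed (range (divhull_embed :: 'a \<Rightarrow> 'a divhull))"
  obtain n and C :: "'a set" where n: "n \<ge> 1"
    and C: "is_subgroup C" "order_convex_in UNIV C" "n_regular n C"
    and ndiv: "\<not> n_divisible n C"
    using assms(2) by blast
  have "nsmul n ` C \<subseteq> C"
    using nsmul_in_subgroup[OF C(1)] by auto
  then obtain c where c: "c \<in> C" "c \<notin> nsmul n ` C"
    using ndiv unfolding n_divisible_def by blast
  have "0 \<in> nsmul n ` C"
    using C(1) by (auto simp: is_subgroup_def intro!: image_eqI[of _ _ 0])
  with c have c0: "c \<noteq> 0"
    by auto
  obtain q where q: "nsmul n q = divhull_embed c"
    using divhull_divisible[of n "divhull_embed c"] n by auto
  have "q \<notin> range divhull_embed"
  proof
    assume "q \<in> range divhull_embed"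
    then obtain g where "divhull_embed (nsmul n g) = divhull_embed c"
      using q by (auto simp: divhull_embed_nsmul)
    then have "nsmul n g = c"
      by (rule injD[OF inj_divhull_embed])
    then show False
      using convex_subgroup_divisor[OF C(1,2) n, of g] c by auto
  qed
  then have q_in: "q \<in> - range divhull_embed"
    by simp
  \<comment> \<open>\<open>open_right\<close> asks for some point above \<open>q\<close>; adding the
    nonzero absolute value of \<open>c\<close> provides one.\<close>
  define p where "p = divhull_embed (max c (- c))"
  have "divhull_embed 0 < p"
    unfolding p_def divhull_embed_less_iff using c0 by (auto simp: max_def)
  then have "q < q + p"
    by (simp add: divhull_embed_zero)
  \<comment> \<open>The complement of a closed range is open, so a gap opens to the right of
    \<open>q\<close>; approximation from above is enough to refute it.\<close>
  from open_right[OF _ q_in this] closed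
  obtain b where b: "q < b" "{q..<b} \<subseteq> - range divhull_embed"
    by (auto simp: closed_def)
  obtain d :: 'a where d: "0 < d" "divhull_embed d \<le> b - q"
    using divhull_embed_below[OF assms(1), of "b - q"] b(1) by auto
  obtain z where z: "c < nsmul n z" "nsmul n z < c + d"
    using n_regular_approx[OF assms(1) C c(1) c0 d(1)] by blast
  have "nsmul n q < nsmul n (divhull_embed z)"
    using z(1) by (simp add: q divhull_embed_less_iff flip: divhull_embed_nsmul)
  then have "q < divhull_embed z"
    using n by simp
  have "nsmul n (divhull_embed z) < divhull_embed c + divhull_embed d"
    using z(2) by (simp add: divhull_embed_less_iff flip: divhull_embed_nsmul divhull_embed_add)
  also have "\<dots> \<le> nsmul n q + (b - q)"
    using d(2) by (simp add: q)
  \<comment> \<open>The gap need not be divided by \<open>n\<close>: as \<open>b - q\<close> is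
    positive, it is at most its own \<open>n\<close>-fold multiple, and \<open>n\<close> then
    cancels.\<close>
  also have "\<dots> \<le> nsmul n q + nsmul n (b - q)"
    using le_nsmul[OF n, of "b - q"] b(1) by simp
  also have "\<dots> = nsmul n b"
    by (simp flip: nsmul_add)
  finally have "divhull_embed z < b"
    using n by simp
  with \<open>q < divhull_embed z\<close> have "divhull_embed z \<in> {q..<b}"
    by simp
  with b(2) show False
    by blast
qed

end
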